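(* Let $f:\mathbb{N}\to\mathbb{C}$ be an arithmetic function (where $\mathbb{N}=\{1,2,3,\dots\}$) for which there is a finite limit of the average value $$\lim_{x\to\infty}\frac{1}{x}\sum_{n\le x} f(n)=c,\qquad c\neq 0.$$ Then for every real $s\ge 1$, $$\sum_{n\le x} n^s f(n)\sim \frac{c}{s+1}x^{s+1},\qquad x\to\infty.$$
   Context: An arithmetic function is a function defined on the positive integers with complex values. Sums $\sum_{n\le x}$ run over positive integers $n\le x$. The notation $A(x)\sim B(x)$ as $x\to\infty$ means $A(x)/B(x)\to 1$. *)

theory Defs
  imports "HOL-Analysis.Analysis" "HOL-Library.Landau_Symbols"
begin

unbundle asymp_equiv_syntax

(* An arithmetic function is a function on type nat whose value at 0 never
   enters: summation ranges over the positive integers up to the real bound x. *)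
definition sum_pos_upto :: "(nat \<Rightarrow> complex) \<Rightarrow> real \<Rightarrow> complex" where
  "sum_pos_upto f x = (\<Sum>n | 1 \<le> n \<and> real n \<le> x. f n)"

end

(* Write f = c + g, so that the partial sums of g are o(x).  By Abel summation with the increasing
   weights n^s, the weighted sum of g is at most 2 N^s times the largest partial sum of g up to N,
   hence o(N^(s+1)); the constant c contributes c times the sum of n^s, which telescoping
   the mean value theorem for t^(s+1) shows to be N^(s+1)/(s+1) + O(N^s). *)
theory Submission
  imports Defs "HOL-Real_Asymp.Real_Asymp"
begin

lemma sum_pos_upto_eq: "sum_pos_upto f x = (\<Sum>n=1..nat \<lfloor>x\<rfloor>. f n)"
proof -
  have "{n. 1 \<le> n \<and> real n \<le> x} = {1..nat \<lfloor>x\<rfloor>}"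
    by (auto simp: le_nat_floor) linarith
  then show ?thesis
    by (simp add: sum_pos_upto_def)
qed

text \<open>The difference sum starts at \<open>n = 0\<close>, where the inner partial sum is empty,
  so \<open>a 0\<close> contributes nothing and no boundary term appears at the lower end.\<close>

lemma summation_by_parts:
  fixes g :: "nat \<Rightarrow> 'a::real_vector" and a :: "nat \<Rightarrow> real"
  shows "(\<Sum>n=1..N. a n *\<^sub>R g n) =
    a N *\<^sub>R (\<Sum>n=1..N. g n) - (\<Sum>n<N. (a (Suc n) - a n) *\<^sub>R (\<Sum>k=1..n. g k))"
  by (induction N) (simp_all add: algebra_simps)

text \<open>Monotonicity makes the increments of \<open>a\<close> nonnegative, so they survive
  taking norms and telescope to \<open>a N - a 0\<close>, which is at most \<open>a N\<close>. This
  gives one \<open>a N * B\<close>; the boundary term of the summation by parts gives the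
  other.\<close>

lemma norm_weighted_sum_le:
  fixes g :: "nat \<Rightarrow> 'a::real_normed_vector" and a :: "nat \<Rightarrow> real"
  assumes a: "mono a" "a 0 \<ge> 0" and B: "\<And>n. n \<le> N \<Longrightarrow> norm (\<Sum>k=1..n. g k) \<le> B"
  shows "norm (\<Sum>n=1..N. a n *\<^sub>R g n) \<le> 2 * a N * B"
proof -
  let ?G = "\<lambda>n. \<Sum>k=1..n. g k"
  have B0: "B \<ge> 0"
    using B[of 0] by simp
  have aN: "a N \<ge> 0"
    using a monoD[of a 0 N] by linarith
  have "norm (\<Sum>n<N. (a (Suc n) - a n) *\<^sub>R ?G n) \<le> (\<Sum>n<N. (a (Suc n) - a n) * B)"
  proof (rule sum_norm_le)
    fix n assume "n \<in> {..<N}"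
    then show "norm ((a (Suc n) - a n) *\<^sub>R ?G n) \<le> (a (Suc n) - a n) * B"
      using B[of n] monoD[OF a(1), of n "Suc n"] by (auto intro!: mult_mono)
  qed
  also have "\<dots> = (a N - a 0) * B"
    by (simp add: sum_lessThan_telescope flip: sum_distrib_right)
  also have "\<dots> \<le> a N * B"
    using a B0 by (intro mult_right_mono) auto
  finally have "norm (\<Sum>n<N. (a (Suc n) - a n) *\<^sub>R ?G n) \<le> a N * B" .
  moreover have "norm (a N *\<^sub>R ?G N) \<le> a N * B"
    using aN B[of N] by (auto intro!: mult_left_mono)
  ultimately show ?thesis
    unfolding summation_by_parts
    using norm_triangle_ineq4[of "a N *\<^sub>R ?G N" "\<Sum>n<N. (a (Suc n) - a n) *\<^sub>R ?G n"] by linarith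
qed

lemma tendsto_zero_weighted_mean:
  fixes g :: "nat \<Rightarrow> 'a::real_normed_vector"
  assumes lim: "(\<lambda>N. (\<Sum>n=1..N. g n) /\<^sub>R real N) \<longlonglongrightarrow> 0" and s: "s \<ge> 0"
  shows "(\<lambda>N. (\<Sum>n=1..N. (real n powr s) *\<^sub>R g n) /\<^sub>R real N powr (s + 1)) \<longlonglongrightarrow> 0"
proof (rule LIMSEQ_I)
  fix r :: real assume r: "r > 0"
  let ?G = "\<lambda>n. \<Sum>k=1..n. g k"
  \<comment> \<open>The final bound is \<open>2 * (e * N + K)\<close>. Once
    \<open>2 * K < e * N\<close>, it lies below \<open>3 * e * N = r * N\<close>.\<close>
  define e where "e = r / 3"
  have e: "e > 0"
    using r by (simp add: e_def)
  obtain n0 where n0: "\<And>n. n \<ge> n0 \<Longrightarrow> norm (?G n /\<^sub>R real n) < e"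
    using LIMSEQ_D[OF lim e] by auto
  \<comment> \<open>Partial sums before \<open>n0\<close> are not controlled by \<open>e\<close>. As
    a sum of all their norms, \<open>K\<close> dominates each of them, which yields a linear bound
    valid for every \<open>n\<close>, as a bound uniform in \<open>n \<le> N\<close>
    demands.\<close>
  define K where "K = (\<Sum>n<n0. norm (?G n))"
  have K0: "K \<ge> 0"
    unfolding K_def by (intro sum_nonneg) auto
  have G: "norm (?G n) \<le> e * real n + K" for n
  proof (cases "n < n0")
    case True
    then have "norm (?G n) \<le> K"
      unfolding K_def by (intro member_le_sum) auto
    then show ?thesis
      using e by (simp add: add_increasing)
  next
    case False
    \<comment> \<open>At \<open>n = 0\<close> the choice of \<open>n0\<close> says nothing, since
      the mean is a division by zero; there the partial sum is empty.\<close>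
    then have "norm (?G n) \<le> e * real n"
      using n0[of n] by (cases "n = 0") (auto simp: field_simps)
    then show ?thesis
      using K0 by simp
  qed
  have "norm (\<Sum>n=1..N. (real n powr s) *\<^sub>R g n) \<le> 2 * real N powr s * (e * real N + K)" for N
  proof (rule norm_weighted_sum_le)
    show "mono (\<lambda>n. real n powr s)"
      using s by (auto intro!: monoI powr_mono2)
    show "norm (?G n) \<le> e * real N + K" if "n \<le> N" for n
      using G[of n] that e by (smt (verit) mult_left_mono of_nat_mono)
  qed simp
  moreover obtain N0 where N0: "real N0 > 2 * K / e" "N0 > 0"
    using reals_Archimedean2[of "2 * K / e"] K0 e
    by (smt (verit) divide_nonneg_pos of_nat_0_less_iff)
  ultimately have "norm ((\<Sum>n=1..N. (real n powr s) *\<^sub>R g n) /\<^sub>R real N powr (s + 1) - 0) < r"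
    if "N \<ge> N0" for N
  proof -
    have N: "real N > 0" "real N > 2 * K / e"
      using N0 that by linarith+
    have "norm (\<Sum>n=1..N. (real n powr s) *\<^sub>R g n) \<le> 2 * real N powr s * (e * real N + K)"
      by fact
    also have "2 * (e * real N + K) < r * real N"
      using N(2) e by (simp add: e_def field_simps)
    then have "2 * real N powr s * (e * real N + K) < r * real N powr (s + 1)"
      using N by (simp add: powr_add mult.assoc mult.left_commute)
    finally show ?thesis
      using N by (simp add: field_simps)
  qed
  then show "\<exists>no. \<forall>N\<ge>no.
      norm ((\<Sum>n=1..N. (real n powr s) *\<^sub>R g n) /\<^sub>R real N powr (s + 1) - 0) < r"
    by blast
qed

lemma powr_Suc_diff_bounds:
  fixes s :: real
  assumes "s \<ge> 0"
  shows "(s + 1) * real n powr s \<le> real (Suc n) powr (s + 1) - real n powr (s + 1)"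
    and "real (Suc n) powr (s + 1) - real n powr (s + 1) \<le> (s + 1) * real (Suc n) powr s"
proof -
  have "continuous_on {real n..real (Suc n)} (\<lambda>t. t powr (s + 1))"
    using assms by (intro continuous_on_powr' continuous_intros) auto
  \<comment> \<open>The derivative is needed only in the open interval, so the end point 0 in the
    case \<open>n = 0\<close> is avoided.\<close>
  moreover have "((\<lambda>t. t powr (s + 1)) has_real_derivative (s + 1) * t powr s) (at t)"
    if "t > real n" for t
    using that by (auto intro!: derivative_eq_intros)
  ultimately obtain t where t: "real n < t" "t < real (Suc n)"
    and eq: "real (Suc n) powr (s + 1) - real n powr (s + 1) =
      (s + 1) * t powr s"
    using mvt[of "real n" "real (Suc n)" "\<lambda>t. t powr (s + 1)" "\<lambda>t. (*) ((s + 1) * t powr s)"]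
    by (auto simp: has_field_derivative_def)
  \<comment> \<open>The derivative \<open>(s + 1) * t powr s\<close> is nondecreasing in
    \<open>t\<close>, so its values at the two end points enclose the one at the intermediate
    point.\<close>
  then show "(s + 1) * real n powr s \<le> real (Suc n) powr (s + 1) - real n powr (s + 1)"
    and "real (Suc n) powr (s + 1) - real n powr (s + 1) \<le> (s + 1) * real (Suc n) powr s"
    using assms by (auto intro!: mult_left_mono powr_mono2)
qed

text \<open>Both bounds telescope the differences of consecutive powers. In the second the weights
  sit at left end points, so the telescoping covers only the terms below \<open>N\<close>; the last
  one is the extra \<open>(s + 1) * real N powr s\<close>.\<close>

lemma sum_powr_bounds:
  fixes s :: real
  assumes "s \<ge> 0"
  shows "real N powr (s + 1) \<le> (s + 1) * (\<Sum>n=1..N. real n powr s)"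
    and "(s + 1) * (\<Sum>n=1..N. real n powr s) \<le> real N powr (s + 1) + (s + 1) * real N powr s"
proof -
  show "real N powr (s + 1) \<le> (s + 1) * (\<Sum>n=1..N. real n powr s)"
  proof (induction N)
    case (Suc N)
    then show ?case
      using powr_Suc_diff_bounds(2)[OF assms, of N] by (simp add: distrib_left)
  qed simp
  show "(s + 1) * (\<Sum>n=1..N. real n powr s) \<le> real N powr (s + 1) + (s + 1) * real N powr s"
  proof (induction N)
    case (Suc N)
    then show ?case
      using powr_Suc_diff_bounds(1)[OF assms, of N] by (simp add: distrib_left)
  qed simp
qed

lemma tendsto_sum_powr:
  fixes s :: real
  assumes "s \<ge> 0"
  shows "(\<lambda>N. (\<Sum>n=1..N. real n powr s) / real N powr (s + 1)) \<longlonglongrightarrow> 1 / (s + 1)"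
proof (rule tendsto_sandwich)
  show "\<forall>\<^sub>F N in sequentially.
      1 / (s + 1) \<le> (\<Sum>n=1..N. real n powr s) / real N powr (s + 1)"
    \<comment> \<open>At \<open>N = 0\<close> the quotient is 0 by the convention for division, and
      the lower bound fails.\<close>
    using eventually_gt_at_top[of 0]
    by eventually_elim
      (use sum_powr_bounds(1)[OF assms] assms in \<open>simp add: field_simps\<close>)
  show "\<forall>\<^sub>F N in sequentially.
      (\<Sum>n=1..N. real n powr s) / real N powr (s + 1) \<le> 1 / (s + 1) + 1 / real N"
    using eventually_gt_at_top[of 0]
  proof eventually_elim
    case (elim N)
    have "(\<Sum>n=1..N. real n powr s) \<le> real N powr (s + 1) / (s + 1) + real N powr s"
      using sum_powr_bounds(2)[OF assms, of N] assms by (simp add: field_simps)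
    then have "(\<Sum>n=1..N. real n powr s) / real N powr (s + 1) \<le>
        (real N powr (s + 1) / (s + 1) + real N powr s) / real N powr (s + 1)"
      by (intro divide_right_mono) auto
    also have "\<dots> = 1 / (s + 1) + 1 / real N"
      using elim by (simp add: add_divide_distrib powr_add)
    finally show ?case .
  qed
  show "(\<lambda>N. 1 / (s + 1) + 1 / real N) \<longlonglongrightarrow> 1 / (s + 1)"
    by real_asymp
qed simp

lemma tendsto_weighted_mean:
  fixes f :: "nat \<Rightarrow> 'a::real_normed_vector"
  assumes lim: "(\<lambda>N. (\<Sum>n=1..N. f n) /\<^sub>R real N) \<longlonglongrightarrow> c" and s: "s \<ge> 0"
  shows "(\<lambda>N. (\<Sum>n=1..N. (real n powr s) *\<^sub>R f n) /\<^sub>R real N powr (s + 1)) \<longlonglongrightarrow> c /\<^sub>R (s + 1)"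
proof -
  have "\<forall>\<^sub>F N in sequentially.
      (\<Sum>n=1..N. f n) /\<^sub>R real N - c = (\<Sum>n=1..N. f n - c) /\<^sub>R real N"
    using eventually_gt_at_top[of 0]
    by eventually_elim (simp add: sum_subtractf scaleR_diff_right sum_constant_scaleR)
  then have "(\<lambda>N. (\<Sum>n=1..N. f n - c) /\<^sub>R real N) \<longlonglongrightarrow> 0"
    using lim by (subst (asm) LIM_zero_iff[symmetric]) (simp add: tendsto_cong)
  \<comment> \<open>The deviations from \<open>c\<close> vanish in the weighted mean, and the
    constant part carries the whole limit.\<close>
  then have "(\<lambda>N. (\<Sum>n=1..N. (real n powr s) *\<^sub>R (f n - c)) /\<^sub>R real N powr (s + 1)
      + ((\<Sum>n=1..N. real n powr s) / real N powr (s + 1)) *\<^sub>R c) \<longlonglongrightarrow> 0 + (1 / (s + 1)) *\<^sub>R c"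
    using s by (intro tendsto_add tendsto_zero_weighted_mean tendsto_scaleR tendsto_sum_powr) auto
  moreover have "(\<Sum>n=1..N. (real n powr s) *\<^sub>R (f n - c)) /\<^sub>R real N powr (s + 1)
      + ((\<Sum>n=1..N. real n powr s) / real N powr (s + 1)) *\<^sub>R c
      = (\<Sum>n=1..N. (real n powr s) *\<^sub>R f n) /\<^sub>R real N powr (s + 1)" for N
    by (simp add: scaleR_diff_right sum_subtractf divide_inverse_commute
        flip: scaleR_left.sum scaleR_scaleR)
  ultimately show ?thesis
    by (simp add: inverse_eq_divide)
qed

theorem mainTheorem3:
  fixes f :: "nat \<Rightarrow> complex" and c :: complex
  assumes "((\<lambda>x::real. 1 / complex_of_real x * sum_pos_upto f x) \<longlongrightarrow> c) at_top"
    and "c \<noteq> 0"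
  shows "\<forall>s::real. s \<ge> 1 \<longrightarrow>
    (\<lambda>x::real. sum_pos_upto (\<lambda>n. complex_of_real (real n powr s) * f n) x)
      \<sim>[at_top] (\<lambda>x. c / complex_of_real (s + 1) * complex_of_real (x powr (s + 1)))"
proof (intro allI impI)
  fix s :: real assume s: "s \<ge> 1"
  let ?S = "\<lambda>N. \<Sum>n=1..N. (real n powr s) *\<^sub>R f n"
  \<comment> \<open>The hypothesis on real \<open>x\<close> is restricted to integers, where the
    sequence lemmas apply.\<close>
  have "(\<lambda>N. (\<Sum>n=1..N. f n) /\<^sub>R real N) \<longlonglongrightarrow> c"
    using filterlim_compose[OF assms(1) filterlim_real_sequentially]
    by (simp add: sum_pos_upto_eq scaleR_conv_of_real inverse_eq_divide)
  then have "(\<lambda>N. ?S N /\<^sub>R real N powr (s + 1)) \<longlonglongrightarrow> c /\<^sub>R (s + 1)"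
    using s by (intro tendsto_weighted_mean) auto
  moreover have "filterlim (\<lambda>x::real. nat \<lfloor>x\<rfloor>) sequentially at_top"
    by (intro filterlim_compose[OF filterlim_nat_sequentially] filterlim_floor_sequentially)
  ultimately have "((\<lambda>x::real. ?S (nat \<lfloor>x\<rfloor>) /\<^sub>R real (nat \<lfloor>x\<rfloor>) powr (s + 1)) \<longlongrightarrow>
      c /\<^sub>R (s + 1)) at_top"
    by (rule filterlim_compose)
  \<comment> \<open>Composing with the floor leaves the floor of \<open>x\<close> in the denominator
    as well. This factor, tending to 1, exchanges it for \<open>x\<close>.\<close>
  moreover have "((\<lambda>x::real. (real_of_int \<lfloor>x\<rfloor> / x) powr (s + 1)) \<longlongrightarrow> 1 powr (s + 1)) at_top"
    by (intro tendsto_powr tendsto_const) (real_asymp | simp)+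
  ultimately have "((\<lambda>x. (real_of_int \<lfloor>x\<rfloor> / x) powr (s + 1) *\<^sub>R
      (?S (nat \<lfloor>x\<rfloor>) /\<^sub>R real (nat \<lfloor>x\<rfloor>) powr (s + 1))) \<longlongrightarrow> 1 powr (s + 1) *\<^sub>R (c /\<^sub>R (s + 1))) at_top"
    by (rule tendsto_scaleR[rotated])
  moreover have "\<forall>\<^sub>F x in at_top. (real_of_int \<lfloor>x\<rfloor> / x) powr (s + 1) *\<^sub>R
      (?S (nat \<lfloor>x\<rfloor>) /\<^sub>R real (nat \<lfloor>x\<rfloor>) powr (s + 1)) = ?S (nat \<lfloor>x\<rfloor>) /\<^sub>R x powr (s + 1)"
    using eventually_ge_at_top[of 1]
  proof eventually_elim
    \<comment> \<open>For \<open>x \<ge> 1\<close> the floor is nonzero, so its power really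
      cancels.\<close>
    case (elim x)
    have "(real_of_int \<lfloor>x\<rfloor> / x) powr (s + 1) = real_of_int \<lfloor>x\<rfloor> powr (s + 1) / x powr (s + 1)"
      by (rule powr_divide)
    moreover have "\<lfloor>x\<rfloor> \<noteq> 0"
      using elim by linarith
    ultimately show ?case
      using elim by (simp add: divide_inverse)
  qed
  ultimately have "((\<lambda>x. ?S (nat \<lfloor>x\<rfloor>) /\<^sub>R x powr (s + 1)) \<longlongrightarrow>
      1 powr (s + 1) *\<^sub>R (c /\<^sub>R (s + 1))) at_top"
    by (rule Lim_transform_eventually)
  \<comment> \<open>Asymptotic equivalence is shown through a quotient tending to 1; dividing by the
    limit is legitimate because \<open>c \<noteq> 0\<close>.\<close>
  then have "((\<lambda>x. ?S (nat \<lfloor>x\<rfloor>) /\<^sub>R x powr (s + 1) / (c /\<^sub>R (s + 1))) \<longlongrightarrow>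
      1 powr (s + 1) *\<^sub>R (c /\<^sub>R (s + 1)) / (c /\<^sub>R (s + 1))) at_top"
    using s assms(2) by (intro tendsto_divide tendsto_const) auto
  moreover have "?S (nat \<lfloor>x\<rfloor>) /\<^sub>R x powr (s + 1) / (c /\<^sub>R (s + 1)) =
      sum_pos_upto (\<lambda>n. complex_of_real (real n powr s) * f n) x /
        (c / complex_of_real (s + 1) * complex_of_real (x powr (s + 1)))" for x
    by (simp add: sum_pos_upto_eq scaleR_conv_of_real divide_inverse)
  ultimately show "(\<lambda>x::real. sum_pos_upto (\<lambda>n. complex_of_real (real n powr s) * f n) x)
      \<sim>[at_top] (\<lambda>x. c / complex_of_real (s + 1) * complex_of_real (x powr (s + 1)))"
    using s assms(2) by (intro asymp_equivI') simp
qed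

end
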